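(* Fix $T_0>0$. Let $T_0\le T<\tilde T$, let $g\in C^2[0,\tilde T]$ with $g\ge c_g>0$, let $u_0\in L^2(\Omega)$ and $\psi,\tilde\psi\in L^2(\Omega)$, and let $u,\tilde u$ be the solutions of problem (P) with initial data $u_0$ and sources $g(t)\psi(x)$, $g(t)\tilde\psi(x)$ respectively. Then there is a constant $c>0$, depending on $\alpha,\Omega,q,T_0,c_g$ and $\|g\|_{C^2[0,\tilde T]}$ but not otherwise on $T,\tilde T,\psi,\tilde\psi,u_0$, such that $$\|\psi-\tilde\psi\|_{L^2(\Omega)}\le c\Big(\|A(u(T)-\tilde u(\tilde T))\|_{L^2(\Omega)}+|T-\tilde T|\,T^{-1-\alpha}\|u_0\|_{L^2(\Omega)}+|T-\tilde T|(1+T^{-1}+T)\|\tilde\psi\|_{L^2(\Omega)}\Big).$$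
   Context: Let $\Omega\subset\mathbb{R}^d$ ($d=1,2,3$) be an open bounded smooth domain, $\alpha\in(0,1)$, and $q\in L^\infty(\Omega)$, $q\ge0$, a fixed known potential. Let $A=-\Delta+q$ with zero Dirichlet boundary condition on $L^2(\Omega)$, with eigenvalues $0<\lambda_1\le\lambda_2\le\dots\to\infty$ and $L^2$-orthonormal eigenfunctions $\{\varphi_n\}$. $E_{\alpha,\beta}(z)=\sum_{k\ge0}z^k/\Gamma(k\alpha+\beta)$; $F(t)v=\sum_nE_{\alpha,1}(-\lambda_nt^\alpha)(v,\varphi_n)\varphi_n$, $E(t)v=\sum_nt^{\alpha-1}E_{\alpha,\alpha}(-\lambda_nt^\alpha)(v,\varphi_n)\varphi_n$. Problem (P) is $\partial_t^\alpha u-\Delta u+qu=f$ in $\Omega\times(0,\infty)$, $u=0$ on $\partial\Omega$, $u(0)=u_0$, with the Caputo derivative of order $\alpha$; its solution is $u(t)=F(t)u_0+\int_0^tE(t-s)f(s)\,ds$. *)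

theory Defs
  imports "HOL-Analysis.Analysis"
begin

text \<open>Abstract spectral model of L^2(Omega) and of A = -Delta + q (Dirichlet):
  a real Hilbert space 'h with a complete orthonormal system phi n of eigenfunctions
  and eigenvalues lam n, with 0 < lam 0 \<le> lam 1 \<le> ... \<rightarrow> \<infinity>.\<close>

definition spectral_data :: "(nat \<Rightarrow> 'h::{real_inner,complete_space}) \<Rightarrow> (nat \<Rightarrow> real) \<Rightarrow> bool" where
  "spectral_data phi lam \<longleftrightarrow>
     (\<forall>m n. inner (phi m) (phi n) = (if m = n then 1 else 0)) \<and>
     (\<forall>v. (\<forall>n. inner v (phi n) = 0) \<longrightarrow> v = 0) \<and>
     0 < lam 0 \<and> mono lam \<and> filterlim lam at_top sequentially"

definition mittag_leffler :: "real \<Rightarrow> real \<Rightarrow> real \<Rightarrow> real" where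
  "mittag_leffler a b z = (\<Sum>k. z ^ k / Gamma (real k * a + b))"

definition solF :: "(nat \<Rightarrow> 'h::{real_inner,complete_space}) \<Rightarrow> (nat \<Rightarrow> real) \<Rightarrow> real \<Rightarrow> real \<Rightarrow> 'h \<Rightarrow> 'h" where
  "solF phi lam a t v = (\<Sum>n. (mittag_leffler a 1 (- lam n * t powr a) * inner v (phi n)) *\<^sub>R phi n)"

definition solE :: "(nat \<Rightarrow> 'h::{real_inner,complete_space}) \<Rightarrow> (nat \<Rightarrow> real) \<Rightarrow> real \<Rightarrow> real \<Rightarrow> 'h \<Rightarrow> 'h" where
  "solE phi lam a t v = (\<Sum>n. (t powr (a - 1) * mittag_leffler a a (- lam n * t powr a) * inner v (phi n)) *\<^sub>R phi n)"

definition solP :: "(nat \<Rightarrow> 'h::{real_inner,complete_space}) \<Rightarrow> (nat \<Rightarrow> real) \<Rightarrow> real \<Rightarrow> 'h \<Rightarrow> (real \<Rightarrow> 'h) \<Rightarrow> real \<Rightarrow> 'h" where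
  "solP phi lam a u0 f t = solF phi lam a t u0 + integral {0..t} (\<lambda>s. solE phi lam a (t - s) (f s))"

definition opA :: "(nat \<Rightarrow> 'h::{real_inner,complete_space}) \<Rightarrow> (nat \<Rightarrow> real) \<Rightarrow> 'h \<Rightarrow> 'h" where
  "opA phi lam v = (\<Sum>n. (lam n * inner v (phi n)) *\<^sub>R phi n)"

definition domA :: "(nat \<Rightarrow> 'h::{real_inner,complete_space}) \<Rightarrow> (nat \<Rightarrow> real) \<Rightarrow> 'h set" where
  "domA phi lam = {v. summable (\<lambda>n. (lam n * inner v (phi n))\<^sup>2)}"

definition C2_bounded :: "real \<Rightarrow> real \<Rightarrow> (real \<Rightarrow> real) \<Rightarrow> bool" where
  "C2_bounded T' M g \<longleftrightarrow> (\<exists>g1 g2.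
     (\<forall>t\<in>{0..T'}. (g has_real_derivative g1 t) (at t within {0..T'})) \<and>
     (\<forall>t\<in>{0..T'}. (g1 has_real_derivative g2 t) (at t within {0..T'})) \<and>
     continuous_on {0..T'} g2 \<and>
     (\<forall>t\<in>{0..T'}. \<bar>g t\<bar> \<le> M \<and> \<bar>g1 t\<bar> \<le> M \<and> \<bar>g2 t\<bar> \<le> M))"

end

theory Submission
  imports Defs
begin

text \<open>
  In the eigenbasis the problem decouples into scalar modes. Write \<open>e(t)\<close> for
  \<open>mittag_leffler a 1 (- lam n * t powr a)\<close>, \<open>k(t)\<close> for the \<open>n\<close>-th coefficient of \<open>solE\<close>, so
  that \<open>e' = - lam n * k\<close>, and \<open>G(t)\<close> for the convolution of \<open>k\<close> with \<open>g\<close>. The \<open>n\<close>-th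
  coefficient of \<open>u(T) - u'(T')\<close> is \<open>(e(T) - e(T')) u0 + G(T) psi - G(T') psi'\<close>. If \<open>k \<ge> 0\<close>, then
  \<open>lam n * G(T) \<ge> cg (1 - e(T))\<close> is bounded away from zero, so solving for \<open>psi - psi'\<close> writes it
  as a sum of bounded multipliers applied to \<open>A (u(T) - u'(T'))\<close>, \<open>u0\<close> and \<open>psi'\<close>. The bounds
  \<open>lam n * k(t) = O(1 / t)\<close> and \<open>(lam n)\<^sup>2 * k(t) = O(t powr (- 1 - a))\<close> make the last two
  multipliers of order \<open>T' - T\<close>.

  It remains to see that \<open>mittag_leffler a b (- x)\<close> is nonnegative and decreasing for \<open>b \<ge> a\<close>,
  \<open>x \<ge> 0\<close>. It is the limit of the rescaled Taylor coefficients of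
  \<open>(1 - z) powr (a - b) / ((1 - z) powr a + mu)\<close> with \<open>mu = x * n powr - a\<close>. As all coefficients of
  \<open>(1 - z) powr a\<close> except the constant one are nonpositive, these Taylor coefficients satisfy a
  recursion from which nonnegativity and monotonicity in \<open>mu\<close> are immediate. Monotonicity gives
  \<open>mittag_leffler a b (- x) \<le> b * mittag_leffler a (b + 1) (- x)\<close>, while nonnegativity gives
  \<open>x * mittag_leffler a (b + 1) (- x) \<le> 1 / Gamma (b + 1 - a)\<close>; together they yield decay of order
  \<open>1 / x\<close>. As \<open>mittag_leffler a a / a\<close> is the derivative of \<open>mittag_leffler a 1\<close>, the mean value
  theorem improves this to \<open>1 / x\<^sup>2\<close> for \<open>b = a\<close>.
\<close>

section \<open>Negative binomial coefficients\<close>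

text \<open>The coefficient of \<open>z ^ n\<close> in \<open>(1 - z) powr - b\<close>.\<close>

definition neg_binom :: "real \<Rightarrow> nat \<Rightarrow> real" where
  "neg_binom b n = pochhammer b n / fact n"

lemma neg_binom_0 [simp]: "neg_binom b 0 = 1"
  by (simp add: neg_binom_def)

lemma neg_binom_Suc: "neg_binom b (Suc n) = (b + real n) / real (Suc n) * neg_binom b n"
  by (simp add: neg_binom_def pochhammer_Suc)

lemma neg_binom_plus1:
  assumes "b \<noteq> 0"
  shows "neg_binom (b + 1) n = (b + real n) / b * neg_binom b n"
  using assms pochhammer_rec[of b n] pochhammer_rec'[of b n]
  by (simp add: neg_binom_def field_simps)

lemma neg_binom_add: "neg_binom (x + y) n = (\<Sum>i\<le>n. neg_binom x i * neg_binom y (n - i))"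
  unfolding neg_binom_def pochhammer_binomial_sum sum_divide_distrib
  by (intro sum.cong refl) (simp add: binomial_fact)

lemma neg_binom_nonneg: "0 \<le> b \<Longrightarrow> 0 \<le> neg_binom b n"
  by (simp add: neg_binom_def pochhammer_prod prod_nonneg)

lemma neg_binom_minus_Suc_nonpos:
  assumes "0 \<le> a" "a \<le> 1"
  shows "neg_binom (- a) (Suc n) \<le> 0"
proof -
  have "pochhammer (- a) (Suc n) = - a * pochhammer (1 - a) n"
    by (simp add: pochhammer_rec algebra_simps)
  moreover have "0 \<le> pochhammer (1 - a) n"
    using assms by (simp add: pochhammer_prod prod_nonneg)
  ultimately show ?thesis
    using assms by (simp add: neg_binom_def divide_nonpos_pos)
qed

lemma neg_binom_eq_prod: "neg_binom b n = (\<Prod>i<n. 1 + (b - 1) / real (Suc i))"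
  unfolding neg_binom_def pochhammer_prod fact_prod_Suc
  by (simp add: prod_dividef[symmetric] atLeast0LessThan field_simps)

lemma of_nat_mult_power_sums:
  fixes x :: "'a::{real_normed_field,banach}"
  assumes "summable (\<lambda>n. diffs c n * x ^ n)"
  shows "(\<lambda>n. of_nat n * c n * x ^ n) sums (x * (\<Sum>n. diffs c n * x ^ n))"
proof -
  have "x * (of_nat n * c n * x ^ (n - Suc 0)) = of_nat n * c n * x ^ n" for n
    by (cases n) (simp_all add: mult.left_commute mult.assoc)
  then show ?thesis
    using sums_mult[OF diffs_equiv[OF assms], of x] by (simp only:)
qed

lemma summable_neg_binom:
  assumes "norm (x::real) < 1"
  shows "summable (\<lambda>j. neg_binom (real j * a + b) n * x ^ j)"
  using assms
proof (induction n arbitrary: x)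
  case 0
  then show ?case by (simp add: summable_geometric)
next
  case (Suc n)
  define c where "c j = neg_binom (real j * a + b) n" for j
  have summable_c: "summable (\<lambda>j. c j * x ^ j)"
    unfolding c_def by (rule Suc.IH[OF Suc.prems])
  have "summable (\<lambda>j. diffs c j * x ^ j)"
    by (rule termdiff_converges[of x 1]) (use Suc in \<open>auto simp: c_def\<close>)
  then have summable_of_nat_c: "summable (\<lambda>j. real j * c j * x ^ j)"
    using of_nat_mult_power_sums sums_summable by fastforce
  have "neg_binom (real j * a + b) (Suc n) * x ^ j
      = (a * (real j * c j * x ^ j) + (b + real n) * (c j * x ^ j)) / real (Suc n)" for j
    by (simp add: c_def neg_binom_Suc field_simps)
  moreover have "summable (\<lambda>j. (a * (real j * c j * x ^ j) + (b + real n) * (c j * x ^ j)) / real (Suc n))"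
    by (intro summable_divide summable_add summable_mult summable_c summable_of_nat_c)
  ultimately show ?case by simp
qed

definition scaled_neg_binom :: "real \<Rightarrow> nat \<Rightarrow> real" where
  "scaled_neg_binom b n = neg_binom b n / real n powr (b - 1)"

lemma scaled_neg_binom_nonneg: "0 \<le> b \<Longrightarrow> 0 \<le> scaled_neg_binom b n"
  by (simp add: scaled_neg_binom_def neg_binom_nonneg)

lemma scaled_neg_binom_tendsto:
  assumes "0 < b"
  shows "(\<lambda>n. scaled_neg_binom b n) \<longlonglongrightarrow> 1 / Gamma b"
proof (rule Lim_transform_eventually)
  show "(\<lambda>n. 1 / Gamma_series' b n) \<longlonglongrightarrow> 1 / Gamma b"
    using Gamma_real_pos[OF assms] by (intro tendsto_intros Gamma_series'_LIMSEQ) simp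
  show "\<forall>\<^sub>F n in sequentially. 1 / Gamma_series' b n = scaled_neg_binom b n"
    using eventually_gt_at_top[of 0]
  proof eventually_elim
    case (elim n)
    then show ?case
      by (simp add: Gamma_series'_def scaled_neg_binom_def neg_binom_def powr_diff powr_def
          exp_diff left_diff_distrib fact_reduce)
  qed
qed

lemma harm_le_1_plus_ln:
  assumes "0 < n"
  shows "harm n \<le> 1 + ln (real n)"
proof -
  obtain m where "n = Suc m" using assms gr0_implies_Suc by blast
  then show ?thesis
    using decseqD[OF decseq_harm_diff_ln, of 0 m] by (simp add: harm_expand)
qed

lemma scaled_neg_binom_le_exp:
  assumes "0 < b" "0 < n"
  shows "scaled_neg_binom b n \<le> exp b"
proof -
  have "neg_binom b n \<le> (\<Prod>i<n. exp ((b - 1) / real (Suc i)))"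
    unfolding neg_binom_eq_prod
  proof (intro prod_mono conjI)
    fix i
    show "0 \<le> 1 + (b - 1) / real (Suc i)" using assms by (simp add: field_simps)
    show "1 + (b - 1) / real (Suc i) \<le> exp ((b - 1) / real (Suc i))" by (rule exp_ge_add_one_self)
  qed
  also have "\<dots> = exp ((b - 1) * harm n)"
    by (simp add: exp_sum[symmetric] harm_altdef sum_distrib_left divide_inverse)
  also have "(b - 1) * harm n \<le> b + (b - 1) * ln n"
  proof (cases "1 \<le> b")
    case True
    then have "(b - 1) * harm n \<le> (b - 1) * (1 + ln n)"
      using harm_le_1_plus_ln[OF assms(2)] by (intro mult_left_mono) auto
    then show ?thesis by (simp add: algebra_simps)
  next
    case False
    have "ln (real n) \<le> ln (real n + 1)" using assms(2) by simp
    also have "\<dots> \<le> harm n" by (rule ln_le_harm)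
    finally have "(b - 1) * harm n \<le> (b - 1) * ln n"
      using False by (intro mult_left_mono_neg) auto
    then show ?thesis using assms(1) by simp
  qed
  finally show ?thesis
    using assms(2) by (simp add: scaled_neg_binom_def powr_def exp_add pos_divide_le_eq)
qed

lemma scaled_neg_binom_plus1:
  assumes "0 < b" "0 < n"
  shows "scaled_neg_binom (b + 1) n = (1 / b + 1 / real n) * scaled_neg_binom b n"
  using assms
  by (simp add: scaled_neg_binom_def neg_binom_plus1[of b] powr_diff add_divide_distrib distrib_right)

lemma scaled_neg_binom_le_powr:
  assumes "2 \<le> N" "N \<le> real n" "0 < b"
  shows "scaled_neg_binom b n \<le> exp (N + 1) * (2 / N) powr (b - N - 1)"
proof -
  have n: "0 < n" using assms by (cases n) auto
  show ?thesis
    using assms(3)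
  proof (induction "nat \<lceil>b\<rceil>" arbitrary: b rule: less_induct)
    case less
    show ?case
    proof (cases "b \<le> N + 1")
      case True
      have "1 \<le> (N / 2) powr (N + 1 - b)"
        using True assms(1) by (intro ge_one_powr_ge_zero) auto
      also have "\<dots> = (2 / N) powr (b - N - 1)"
        using assms(1) by (simp add: powr_divide powr_diff powr_add field_simps)
      finally have "exp b * 1 \<le> exp (N + 1) * (2 / N) powr (b - N - 1)"
        using True by (intro mult_mono) auto
      then show ?thesis
        using scaled_neg_binom_le_exp[OF less.prems n] by simp
    next
      case False
      define c where "c = b - 1"
      have c: "N \<le> c" "0 < c" "nat \<lceil>c\<rceil> < nat \<lceil>b\<rceil>"
        using False assms(1) by (auto simp: c_def)
      have "scaled_neg_binom b n = (1 / c + 1 / real n) * scaled_neg_binom c n"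
        using scaled_neg_binom_plus1[OF c(2) n] by (simp add: c_def)
      also have "\<dots> \<le> (1 / N + 1 / N) * (exp (N + 1) * (2 / N) powr (c - N - 1))"
        using c assms n scaled_neg_binom_nonneg[of c]
        by (intro mult_mono add_mono divide_left_mono less.hyps) auto
      also have "\<dots> = exp (N + 1) * (2 / N) powr (1 + (c - N - 1))"
        using assms(1) unfolding powr_add by simp
      finally show ?thesis by (simp add: c_def)
    qed
  qed
qed

lemma eventually_mult_powr_minus_less_1:
  assumes "0 < a"
  shows "\<forall>\<^sub>F n in sequentially. x * real n powr - a < 1"
proof -
  have "(\<lambda>n. x * real n powr - a) \<longlonglongrightarrow> x * 0"
    using assms by (intro tendsto_intros tendsto_neg_powr filterlim_real_sequentially) auto
  then show ?thesis by (rule order_tendstoD) simp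
qed

lemma scaled_neg_binom_summable_majorant:
  assumes "0 < a" "0 < b"
  obtains C where "summable C"
    and "\<forall>\<^sub>F n in sequentially. \<forall>k. norm (scaled_neg_binom (real k * a + b) n * x ^ k) \<le> C k"
proof -
  have "\<forall>\<^sub>F N in sequentially. 2 \<le> N \<and> \<bar>x\<bar> * 2 powr a * real N powr - a < 1"
    by (intro eventually_conj eventually_ge_at_top eventually_mult_powr_minus_less_1 assms)
  then obtain N :: nat where N: "2 \<le> N" and "\<bar>x\<bar> * 2 powr a * real N powr - a < 1"
    using eventually_happens' sequentially_bot by blast
  then have ratio: "\<bar>x\<bar> * (2 / N) powr a < 1"
    by (simp add: powr_divide powr_minus_divide)
  define C where "C k = exp (real N + 1) * (2 / N) powr (b - N - 1) * (\<bar>x\<bar> * (2 / N) powr a) ^ k" for k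
  have "summable C"
    unfolding C_def using ratio by (intro summable_mult summable_geometric) simp
  moreover have "norm (scaled_neg_binom (real k * a + b) n * x ^ k) \<le> C k" if "N \<le> n" for n k
  proof -
    have pos: "0 < real k * a + b" using assms by (simp add: add_nonneg_pos)
    have "norm (scaled_neg_binom (real k * a + b) n * x ^ k)
        = scaled_neg_binom (real k * a + b) n * \<bar>x\<bar> ^ k"
      using pos by (simp add: abs_mult power_abs scaled_neg_binom_nonneg)
    also have "\<dots> \<le> exp (real N + 1) * (2 / N) powr (real k * a + b - N - 1) * \<bar>x\<bar> ^ k"
      using scaled_neg_binom_le_powr[of N n, OF _ _ pos] N that by (intro mult_right_mono) auto
    also have "(2 / N) powr (real k * a + b - N - 1) = (2 / N) powr (b - N - 1) * ((2 / N) powr a) ^ k"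
      using N by (simp add: powr_power powr_add[symmetric] algebra_simps)
    finally show ?thesis by (simp add: C_def power_mult_distrib mult_ac)
  qed
  then have "\<forall>\<^sub>F n in sequentially. \<forall>k. norm (scaled_neg_binom (real k * a + b) n * x ^ k) \<le> C k"
    using eventually_sequentially by blast
  ultimately show ?thesis by (rule that)
qed

section \<open>Monotonicity of the Mittag-Leffler function\<close>

lemma
  assumes "0 < a" "0 < b"
  shows suminf_scaled_neg_binom_tendsto:
      "(\<lambda>n. \<Sum>k. scaled_neg_binom (real k * a + b) n * x ^ k) \<longlonglongrightarrow> mittag_leffler a b x"
    and summable_mittag_leffler: "summable (\<lambda>k. x ^ k / Gamma (real k * a + b))"
proof -
  obtain C where C: "summable C"
    and majorant: "\<forall>\<^sub>F n in sequentially. \<forall>k. norm (scaled_neg_binom (real k * a + b) n * x ^ k) \<le> C k"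
    using scaled_neg_binom_summable_majorant[OF assms] .
  have terms_tendsto: "(\<lambda>n. scaled_neg_binom (real k * a + b) n * x ^ k)
      \<longlonglongrightarrow> 1 / Gamma (real k * a + b) * x ^ k" for k
    using assms by (intro tendsto_intros scaled_neg_binom_tendsto) (simp add: add_nonneg_pos)
  have "\<forall>\<^sub>F (k, n) in at_top \<times>\<^sub>F sequentially. norm (scaled_neg_binom (real k * a + b) n * x ^ k) \<le> C k"
    unfolding eventually_prod_filter using majorant
    by (intro exI[of _ "\<lambda>_. True"] exI conjI) auto
  note tannery = tannerys_theorem[OF terms_tendsto this C sequentially_bot]
  then show "(\<lambda>n. \<Sum>k. scaled_neg_binom (real k * a + b) n * x ^ k) \<longlonglongrightarrow> mittag_leffler a b x"
    by (simp add: mittag_leffler_def)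
  from tannery have "summable (\<lambda>k. norm (1 / Gamma (real k * a + b) * x ^ k))" by blast
  then show "summable (\<lambda>k. x ^ k / Gamma (real k * a + b))"
    using summable_norm_cancel by fastforce
qed

text \<open>The coefficient of \<open>z ^ n\<close> in \<open>(1 - z) powr (a - b) / ((1 - z) powr a + mu)\<close>; the
  Laplace transform of \<open>t powr (b - 1) * mittag_leffler a b (- mu * t powr a)\<close> is obtained by
  putting \<open>s\<close> in place of \<open>1 - z\<close>.\<close>

definition ml_coeff :: "real \<Rightarrow> real \<Rightarrow> real \<Rightarrow> nat \<Rightarrow> real" where
  "ml_coeff a b mu n = (\<Sum>j. neg_binom (real j * a + b) n * (- mu) ^ j)"

lemma sum_neg_binom_mult_ml_coeff:
  assumes "0 \<le> mu" "mu < 1"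
  shows "(\<Sum>i\<le>n. neg_binom c i * ml_coeff a b mu (n - i)) = ml_coeff a (b + c) mu n"
proof -
  have mu: "norm (- mu) < 1" using assms by simp
  note summable = summable_neg_binom[OF mu, of a b]
  have "(\<Sum>i\<le>n. neg_binom c i * ml_coeff a b mu (n - i))
      = (\<Sum>i\<le>n. \<Sum>j. neg_binom c i * (neg_binom (real j * a + b) (n - i) * (- mu) ^ j))"
    unfolding ml_coeff_def by (intro sum.cong refl suminf_mult[symmetric] summable)
  also have "\<dots> = (\<Sum>j. \<Sum>i\<le>n. neg_binom c i * (neg_binom (real j * a + b) (n - i) * (- mu) ^ j))"
    by (rule suminf_sum[symmetric]) (intro summable_mult summable)
  also have "\<dots> = (\<Sum>j. neg_binom (c + (real j * a + b)) n * (- mu) ^ j)"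
    by (simp add: neg_binom_add[of c] sum_distrib_right mult.assoc)
  finally show ?thesis by (simp add: ml_coeff_def add_ac)
qed

lemma ml_coeff_eq_neg_binom_minus:
  assumes "0 \<le> mu" "mu < 1"
  shows "ml_coeff a b mu n = neg_binom b n - mu * ml_coeff a (b + a) mu n"
proof -
  have mu: "norm (- mu) < 1" using assms by simp
  note summable = summable_neg_binom[OF mu, of a _ n]
  have "ml_coeff a b mu n
      = neg_binom b n + (\<Sum>j. neg_binom (real (Suc j) * a + b) n * (- mu) ^ Suc j)"
    unfolding ml_coeff_def using suminf_split_head[OF summable, of b] by simp
  also have "(\<Sum>j. neg_binom (real (Suc j) * a + b) n * (- mu) ^ Suc j) = - mu * ml_coeff a (b + a) mu n"
    unfolding ml_coeff_def by (subst suminf_mult[OF summable, symmetric]) (simp add: algebra_simps)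
  finally show ?thesis by simp
qed

lemma ml_coeff_rec:
  assumes "0 \<le> mu" "mu < 1"
  shows "(1 + mu) * ml_coeff a b mu n =
    neg_binom (b - a) n + (\<Sum>i<n. - neg_binom (- a) (Suc i) * ml_coeff a b mu (n - Suc i))"
proof -
  have "ml_coeff a b mu n + (\<Sum>i<n. neg_binom (- a) (Suc i) * ml_coeff a b mu (n - Suc i))
      = (\<Sum>i\<le>n. neg_binom (- a) i * ml_coeff a b mu (n - i))"
    by (simp add: sum.atMost_shift)
  also have "\<dots> = ml_coeff a (b - a) mu n"
    using sum_neg_binom_mult_ml_coeff[OF assms, of "- a"] by simp
  also have "\<dots> = neg_binom (b - a) n - mu * ml_coeff a b mu n"
    using ml_coeff_eq_neg_binom_minus[OF assms, of a "b - a"] by simp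
  finally show ?thesis by (simp add: algebra_simps sum_negf)
qed

lemma ml_coeff_nonneg:
  assumes a: "0 \<le> a" "a \<le> 1" "a \<le> b" and mu: "0 \<le> mu" "mu < 1"
  shows "0 \<le> ml_coeff a b mu n"
proof (induction n rule: less_induct)
  case (less n)
  have "0 \<le> (1 + mu) * ml_coeff a b mu n"
    unfolding ml_coeff_rec[OF mu]
    using a less neg_binom_minus_Suc_nonpos[OF a(1,2)]
    by (intro add_nonneg_nonneg neg_binom_nonneg sum_nonneg mult_nonneg_nonneg) auto
  then show ?case using mu by (simp add: zero_le_mult_iff)
qed

lemma ml_coeff_antimono:
  assumes a: "0 \<le> a" "a \<le> 1" "a \<le> b" and mu: "0 \<le> mu" "mu \<le> nu" "nu < 1"
  shows "ml_coeff a b nu n \<le> ml_coeff a b mu n"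
proof (induction n rule: less_induct)
  case (less n)
  have mu_less_1: "mu < 1" and nu_nonneg: "0 \<le> nu" using mu by auto
  have "(1 + mu) * ml_coeff a b nu n \<le> (1 + nu) * ml_coeff a b nu n"
    using mu ml_coeff_nonneg[OF a nu_nonneg mu(3)] by (intro mult_right_mono) auto
  also have "\<dots> \<le> (1 + mu) * ml_coeff a b mu n"
    unfolding ml_coeff_rec[OF mu(1) mu_less_1] ml_coeff_rec[OF nu_nonneg mu(3)]
    using less neg_binom_minus_Suc_nonpos[OF a(1,2)]
    by (intro add_left_mono sum_mono mult_left_mono) auto
  finally show ?case using mu(1) by simp
qed

lemma ml_coeff_eq_suminf_scaled_neg_binom:
  assumes "0 < n" "0 \<le> x" "x * real n powr - a < 1"
  shows "ml_coeff a b (x * real n powr - a) n / real n powr (b - 1)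
    = (\<Sum>k. scaled_neg_binom (real k * a + b) n * (- x) ^ k)"
proof -
  have "norm (- (x * real n powr - a)) < 1" using assms by simp
  from suminf_divide[OF summable_neg_binom[OF this]]
  have "ml_coeff a b (x * real n powr - a) n / real n powr (b - 1)
      = (\<Sum>k. neg_binom (real k * a + b) n * (- (x * real n powr - a)) ^ k / real n powr (b - 1))"
    by (simp add: ml_coeff_def)
  also have "\<dots> = (\<Sum>k. scaled_neg_binom (real k * a + b) n * (- x) ^ k)"
  proof (rule suminf_cong)
    fix k
    have "(- (x * real n powr - a)) ^ k = (- x) ^ k * (real n powr - a) ^ k"
      by (simp flip: power_mult_distrib)
    also have "(real n powr - a) ^ k = real n powr (- (real k * a))"
      using assms(1) by (simp add: powr_power mult.commute)
    finally show "neg_binom (real k * a + b) n * (- (x * real n powr - a)) ^ k / real n powr (b - 1)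
        = scaled_neg_binom (real k * a + b) n * (- x) ^ k"
      using assms(1) by (simp add: scaled_neg_binom_def powr_diff powr_add powr_minus field_simps)
  qed
  finally show ?thesis .
qed

lemma ml_coeff_tendsto:
  assumes "0 < a" "0 < b" "0 \<le> x"
  shows "(\<lambda>n. ml_coeff a b (x * real n powr - a) n / real n powr (b - 1)) \<longlonglongrightarrow> mittag_leffler a b (- x)"
proof (rule Lim_transform_eventually[OF suminf_scaled_neg_binom_tendsto])
  show "\<forall>\<^sub>F n in sequentially. (\<Sum>k. scaled_neg_binom (real k * a + b) n * (- x) ^ k)
      = ml_coeff a b (x * real n powr - a) n / real n powr (b - 1)"
    using eventually_gt_at_top[of 0] eventually_mult_powr_minus_less_1[OF assms(1), of x]
    by eventually_elim (simp add: ml_coeff_eq_suminf_scaled_neg_binom assms(3))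
qed (use assms in auto)

lemma mittag_leffler_nonneg:
  assumes "0 < a" "a \<le> 1" "a \<le> b" "0 \<le> x"
  shows "0 \<le> mittag_leffler a b (- x)"
proof (rule tendsto_lowerbound[OF ml_coeff_tendsto])
  show "\<forall>\<^sub>F n in sequentially. 0 \<le> ml_coeff a b (x * real n powr - a) n / real n powr (b - 1)"
    using eventually_mult_powr_minus_less_1[OF assms(1), of x]
    by eventually_elim (use assms in \<open>auto intro!: divide_nonneg_nonneg ml_coeff_nonneg\<close>)
qed (use assms in auto)

lemma mittag_leffler_antimono:
  assumes "0 < a" "a \<le> 1" "a \<le> b" "0 \<le> x" "x \<le> y"
  shows "mittag_leffler a b (- y) \<le> mittag_leffler a b (- x)"
proof (rule tendsto_le[OF _ ml_coeff_tendsto ml_coeff_tendsto])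
  show "\<forall>\<^sub>F n in sequentially. ml_coeff a b (y * real n powr - a) n / real n powr (b - 1)
      \<le> ml_coeff a b (x * real n powr - a) n / real n powr (b - 1)"
    using eventually_mult_powr_minus_less_1[OF assms(1), of y]
    by eventually_elim (use assms in \<open>auto intro!: divide_right_mono ml_coeff_antimono mult_right_mono\<close>)
qed (use assms in auto)

section \<open>Decay of the Mittag-Leffler function\<close>

lemma mittag_leffler_0: "mittag_leffler a b 0 = 1 / Gamma b"
  using powser_zero[of "\<lambda>k. 1 / Gamma (real k * a + b)"] by (simp add: mittag_leffler_def)

lemma mittag_leffler_shift:
  assumes "0 < a" "0 < b"
  shows "z * mittag_leffler a (b + a) z = mittag_leffler a b z - 1 / Gamma b"
proof -
  have "z * mittag_leffler a (b + a) z = (\<Sum>k. z * (z ^ k / Gamma (real k * a + (b + a))))"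
    unfolding mittag_leffler_def using assms
    by (intro suminf_mult[symmetric] summable_mittag_leffler) auto
  also have "\<dots> = (\<Sum>k. z ^ Suc k / Gamma (real (Suc k) * a + b))"
    by (simp add: algebra_simps)
  also have "\<dots> = mittag_leffler a b z - 1 / Gamma b"
    unfolding mittag_leffler_def
    using suminf_split_head[OF summable_mittag_leffler[OF assms], of z] by simp
  finally show ?thesis .
qed

lemma mult_inverse_Gamma_plus1: "z * (1 / Gamma (z + 1)) = 1 / (Gamma z :: real)"
  using rGamma_plus1[of z] by (simp add: rGamma_inverse_Gamma divide_inverse)

lemma mittag_leffler_has_derivative_series:
  assumes "0 < a" "0 < b"
  shows "(mittag_leffler a b has_real_derivative
           (\<Sum>k. diffs (\<lambda>k. 1 / Gamma (real k * a + b)) k * z ^ k)) (at z)"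
proof -
  have "mittag_leffler a b = (\<lambda>z. \<Sum>k. 1 / Gamma (real k * a + b) * z ^ k)"
    by (simp add: mittag_leffler_def fun_eq_iff)
  then show ?thesis
    using termdiffs_strong_converges_everywhere[of "\<lambda>k. 1 / Gamma (real k * a + b)" z]
      summable_mittag_leffler[OF assms] by simp
qed

lemma mittag_leffler_has_derivative:
  assumes "0 < a" "0 < b"
  shows "(mittag_leffler a b has_real_derivative deriv (mittag_leffler a b) z) (at z)"
  using mittag_leffler_has_derivative_series[OF assms] DERIV_imp_deriv by metis

lemma mittag_leffler_1_has_derivative:
  assumes "0 < a"
  shows "(mittag_leffler a 1 has_real_derivative mittag_leffler a a z / a) (at z)"
proof -
  have "diffs (\<lambda>k. 1 / Gamma (real k * a + 1)) k = 1 / Gamma (real k * a + a) / a" for k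
  proof -
    have "diffs (\<lambda>k. 1 / Gamma (real k * a + 1)) k
        = real (Suc k) * a * (1 / Gamma (real (Suc k) * a + 1)) / a"
      using assms by (simp add: diffs_def del: of_nat_Suc)
    also have "\<dots> = 1 / Gamma (real (Suc k) * a) / a"
      by (simp only: mult_inverse_Gamma_plus1)
    also have "real (Suc k) * a = real k * a + a"
      by (simp add: algebra_simps)
    finally show ?thesis .
  qed
  then have "(\<Sum>k. diffs (\<lambda>k. 1 / Gamma (real k * a + 1)) k * z ^ k)
      = (\<Sum>k. z ^ k / Gamma (real k * a + a) / a)"
    by simp
  also have "\<dots> = mittag_leffler a a z / a"
    unfolding mittag_leffler_def using assms by (intro suminf_divide summable_mittag_leffler)
  finally show ?thesis
    using mittag_leffler_has_derivative_series[OF assms zero_less_one, of z] by simp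
qed

lemma mittag_leffler_eq_deriv_plus1:
  assumes "0 < a" "0 < b"
  shows "mittag_leffler a b z
    = a * (z * deriv (mittag_leffler a (b + 1)) z) + b * mittag_leffler a (b + 1) z"
proof -
  define c where "c k = 1 / Gamma (real k * a + (b + 1))" for k
  have summable_c: "summable (\<lambda>k. c k * y ^ k)" for y
    using summable_mittag_leffler[of a "b + 1" y] assms by (simp add: c_def)
  have "deriv (mittag_leffler a (b + 1)) z = (\<Sum>k. diffs c k * z ^ k)"
    unfolding c_def using assms
    by (intro DERIV_imp_deriv mittag_leffler_has_derivative_series) auto
  then have "(\<lambda>k. real k * c k * z ^ k) sums (z * deriv (mittag_leffler a (b + 1)) z)"
    using of_nat_mult_power_sums[OF termdiff_converges_all[OF summable_c]] by simp
  moreover have "(\<lambda>k. c k * z ^ k) sums mittag_leffler a (b + 1) z"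
    using summable_sums[OF summable_c] by (simp add: c_def mittag_leffler_def)
  ultimately have "(\<lambda>k. a * (real k * c k * z ^ k) + b * (c k * z ^ k)) sums
      (a * (z * deriv (mittag_leffler a (b + 1)) z) + b * mittag_leffler a (b + 1) z)"
    by (intro sums_add sums_mult)
  moreover have "a * (real k * c k * z ^ k) + b * (c k * z ^ k) = z ^ k / Gamma (real k * a + b)" for k
  proof -
    have "(real k * a + b) * c k = 1 / Gamma (real k * a + b)"
      using mult_inverse_Gamma_plus1[of "real k * a + b"] by (simp add: c_def add.assoc)
    then have "(real k * a + b) * c k * z ^ k = z ^ k / Gamma (real k * a + b)" by simp
    then show ?thesis by (simp add: algebra_simps)
  qed
  ultimately show ?thesis
    by (simp add: mittag_leffler_def[of a b] sums_iff)
qed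

lemma mittag_leffler_le_plus1:
  assumes "0 < a" "a \<le> 1" "0 < b" "0 \<le> x"
  shows "mittag_leffler a b (- x) \<le> b * mittag_leffler a (b + 1) (- x)"
proof (cases "x = 0")
  case True
  then show ?thesis
    using mittag_leffler_eq_deriv_plus1[of a b 0] assms by simp
next
  case False
  have "mono_on {..0} (mittag_leffler a (b + 1))"
  proof (rule mono_onI)
    fix r s :: real assume "r \<in> {..0}" "s \<in> {..0}" "r \<le> s"
    then show "mittag_leffler a (b + 1) r \<le> mittag_leffler a (b + 1) s"
      using mittag_leffler_antimono[of a "b + 1" "- s" "- r"] assms by simp
  qed
  then have "0 \<le> deriv (mittag_leffler a (b + 1)) (- x)"
    by (rule mono_on_imp_deriv_nonneg[OF _ mittag_leffler_has_derivative])
       (use assms False in auto)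
  then have "a * (- x * deriv (mittag_leffler a (b + 1)) (- x)) \<le> 0"
    using assms by (simp add: mult_nonneg_nonneg)
  then show ?thesis
    using mittag_leffler_eq_deriv_plus1[of a b "- x"] assms by linarith
qed

lemma mult_mittag_leffler_minus_le:
  assumes "0 < a" "a \<le> 1" "0 < b" "2 * a \<le> b + 1" "0 \<le> x"
  shows "x * mittag_leffler a b (- x) \<le> b / Gamma (b + 1 - a)"
proof -
  have "x * mittag_leffler a b (- x) \<le> x * (b * mittag_leffler a (b + 1) (- x))"
    using assms by (intro mult_left_mono mittag_leffler_le_plus1) auto
  also have "\<dots> = b * (1 / Gamma (b + 1 - a) - mittag_leffler a (b + 1 - a) (- x))"
    using mittag_leffler_shift[of a "b + 1 - a" "- x"] assms by (simp add: algebra_simps)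
  also have "\<dots> \<le> b * (1 / Gamma (b + 1 - a))"
    using mittag_leffler_nonneg[of a "b + 1 - a" x] assms by (intro mult_left_mono) auto
  finally show ?thesis by simp
qed

lemma mittag_leffler_1_minus_less_1:
  assumes a: "0 < a" "a \<le> 1" and x: "0 < x"
  shows "mittag_leffler a 1 (- x) < 1"
proof -
  have "0 < mittag_leffler a a 0 / a"
    using a by (simp add: mittag_leffler_0 Gamma_real_pos)
  from DERIV_pos_inc_left[OF mittag_leffler_1_has_derivative[OF a(1)] this]
  obtain d where d: "0 < d" "\<And>h. 0 < h \<Longrightarrow> h < d \<Longrightarrow> mittag_leffler a 1 (- h) < 1"
    by (auto simp: mittag_leffler_0)
  define h where "h = min (d / 2) x"
  have h: "0 < h" "h < d" "h \<le> x" using d(1) x by (auto simp: h_def)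
  have "mittag_leffler a 1 (- x) \<le> mittag_leffler a 1 (- h)"
    using a h by (intro mittag_leffler_antimono) auto
  also have "\<dots> < 1" using h by (intro d(2))
  finally show ?thesis .
qed

lemma mult_mittag_leffler_minus_le_half:
  assumes a: "0 < a" "a \<le> 1" and x: "0 \<le> x"
  shows "x * mittag_leffler a a (- x) \<le> 2 * a * mittag_leffler a 1 (- (x / 2))"
proof (cases "x = 0")
  case True
  then show ?thesis using a by (simp add: mittag_leffler_0)
next
  case False
  then obtain z where z: "- x < z" "z < - (x / 2)"
    and mean_value: "mittag_leffler a 1 (- (x / 2)) - mittag_leffler a 1 (- x)
      = (- (x / 2) - - x) * (mittag_leffler a a z / a)"
    using MVT2[of "- x" "- (x / 2)" "mittag_leffler a 1" "\<lambda>z. mittag_leffler a a z / a"]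
      mittag_leffler_1_has_derivative[OF a(1)] x by auto
  have "x * mittag_leffler a a (- x) \<le> x * mittag_leffler a a z"
    using mittag_leffler_antimono[of a a "- z" x] a z x by (intro mult_left_mono) auto
  also have "\<dots> = 2 * a * (mittag_leffler a 1 (- (x / 2)) - mittag_leffler a 1 (- x))"
    using a unfolding mean_value by simp
  also have "\<dots> \<le> 2 * a * mittag_leffler a 1 (- (x / 2))"
    using mittag_leffler_nonneg[of a 1 x] a x by simp
  finally show ?thesis .
qed

lemma power2_mult_mittag_leffler_minus_le:
  assumes "0 < a" "a \<le> 1" "0 \<le> x"
  shows "x\<^sup>2 * mittag_leffler a a (- x) \<le> 4 * a / Gamma (2 - a)"
proof -
  have "x\<^sup>2 * mittag_leffler a a (- x) = x * (x * mittag_leffler a a (- x))"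
    by (simp add: power2_eq_square)
  also have "\<dots> \<le> x * (2 * a * mittag_leffler a 1 (- (x / 2)))"
    using assms by (intro mult_left_mono mult_mittag_leffler_minus_le_half) auto
  also have "\<dots> = 4 * a * (x / 2 * mittag_leffler a 1 (- (x / 2)))"
    by simp
  also have "\<dots> \<le> 4 * a * (1 / Gamma (1 + 1 - a))"
    using assms by (intro mult_left_mono mult_mittag_leffler_minus_le) auto
  finally show ?thesis by simp
qed

section \<open>The scalar relaxation equation\<close>

definition ml_kernel :: "real \<Rightarrow> real \<Rightarrow> real \<Rightarrow> real" where
  "ml_kernel a l t = t powr (a - 1) * mittag_leffler a a (- l * t powr a)"

definition ml_relax :: "real \<Rightarrow> real \<Rightarrow> real \<Rightarrow> real" where
  "ml_relax a l t = mittag_leffler a 1 (- l * t powr a)"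

lemma ml_kernel_nonneg:
  assumes "0 < a" "a \<le> 1" "0 \<le> l"
  shows "0 \<le> ml_kernel a l t"
  using mittag_leffler_nonneg[of a a "l * t powr a"] assms by (simp add: ml_kernel_def)

lemma ml_kernel_le:
  assumes "0 < a" "a \<le> 1" "0 \<le> l"
  shows "ml_kernel a l t \<le> t powr (a - 1) / Gamma a"
  using mittag_leffler_antimono[of a a 0 "l * t powr a"] assms
  by (simp add: ml_kernel_def mittag_leffler_0 mult_left_mono divide_inverse)

lemma mult_ml_kernel_le:
  assumes "0 < a" "a \<le> 1" "0 \<le> l" "0 < t"
  shows "l * ml_kernel a l t \<le> a / t"
proof -
  have "l * ml_kernel a l t = (l * t powr a) * mittag_leffler a a (- (l * t powr a)) / t"
    using assms by (simp add: ml_kernel_def powr_diff)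
  also have "\<dots> \<le> a / t"
    using mult_mittag_leffler_minus_le[of a a "l * t powr a"] assms
    by (intro divide_right_mono) auto
  finally show ?thesis .
qed

lemma power2_mult_ml_kernel_le:
  assumes "0 < a" "a \<le> 1" "0 \<le> l" "0 < t"
  shows "l\<^sup>2 * ml_kernel a l t \<le> 4 * a / Gamma (2 - a) * t powr (- 1 - a)"
proof -
  have "l\<^sup>2 * ml_kernel a l t
      = (l * t powr a)\<^sup>2 * mittag_leffler a a (- (l * t powr a)) * t powr (- 1 - a)"
    using assms(4) by (simp add: ml_kernel_def powr_diff powr_minus power2_eq_square field_simps)
  also have "\<dots> \<le> 4 * a / Gamma (2 - a) * t powr (- 1 - a)"
    using assms by (intro mult_right_mono power2_mult_mittag_leffler_minus_le) auto
  finally show ?thesis .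
qed

lemma ml_relax_0 [simp]: "0 < a \<Longrightarrow> ml_relax a l 0 = 1"
  by (simp add: ml_relax_def mittag_leffler_0)

lemma ml_relax_nonneg:
  assumes "0 < a" "a \<le> 1" "0 \<le> l"
  shows "0 \<le> ml_relax a l t"
  using mittag_leffler_nonneg[of a 1 "l * t powr a"] assms by (simp add: ml_relax_def)

lemma ml_relax_le_1:
  assumes "0 < a" "a \<le> 1" "0 \<le> l"
  shows "ml_relax a l t \<le> 1"
  using mittag_leffler_antimono[of a 1 0 "l * t powr a"] assms
  by (simp add: ml_relax_def mittag_leffler_0)

lemma ml_relax_less_1:
  assumes "0 < a" "a \<le> 1" "0 < l" "0 < t"
  shows "ml_relax a l t < 1"
  using mittag_leffler_1_minus_less_1[of a "l * t powr a"] assms by (simp add: ml_relax_def)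

lemma ml_relax_antimono:
  assumes "0 < a" "a \<le> 1" "0 \<le> k" "k \<le> l" "0 \<le> s" "s \<le> t"
  shows "ml_relax a l t \<le> ml_relax a k s"
proof -
  have "k * s powr a \<le> l * t powr a"
    using assms by (intro mult_mono powr_mono2) auto
  then show ?thesis
    using mittag_leffler_antimono[of a 1 "k * s powr a" "l * t powr a"] assms
    by (simp add: ml_relax_def)
qed

lemma ml_relax_has_derivative:
  assumes "0 < a" "0 < t"
  shows "(ml_relax a l has_real_derivative (- l * ml_kernel a l t)) (at t)"
proof -
  have "((\<lambda>t. mittag_leffler a 1 (- l * t powr a)) has_real_derivative
      mittag_leffler a a (- l * t powr a) / a * (- l * (a * t powr (a - 1)))) (at t)"
    using assms
    by (intro DERIV_chain2[OF mittag_leffler_1_has_derivative] DERIV_cmult has_real_derivative_powr) auto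
  then show ?thesis
    using assms(1) by (simp add: ml_relax_def[abs_def] ml_kernel_def mult_ac)
qed

lemma continuous_on_ml_relax:
  assumes "0 < a"
  shows "continuous_on {0..} (ml_relax a l)"
proof -
  have "continuous_on UNIV (mittag_leffler a 1)"
    using mittag_leffler_1_has_derivative[OF assms]
    by (blast intro: continuous_at_imp_continuous_on DERIV_isCont)
  then show ?thesis
    unfolding ml_relax_def[abs_def]
    by (rule continuous_on_compose2)
       (use assms in \<open>auto intro!: continuous_intros continuous_on_powr'\<close>)
qed

lemma ml_kernel_has_integral:
  assumes "0 < a" "0 \<le> s" "s \<le> t" "l \<noteq> 0"
  shows "(ml_kernel a l has_integral ((ml_relax a l s - ml_relax a l t) / l)) {s..t}"
proof -
  have "(ml_kernel a l has_integral (- ml_relax a l t / l - (- ml_relax a l s / l))) {s..t}"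
  proof (rule fundamental_theorem_of_calculus_interior[OF assms(3)])
    show "continuous_on {s..t} (\<lambda>t. - ml_relax a l t / l)"
      using assms by (intro continuous_intros continuous_on_subset[OF continuous_on_ml_relax]) auto
    fix x assume x: "x \<in> {s<..<t}"
    have "((\<lambda>t. - ml_relax a l t / l) has_real_derivative (- (- l * ml_kernel a l x) / l)) (at x)"
      using x assms by (intro DERIV_cdivide DERIV_minus ml_relax_has_derivative) auto
    then show "((\<lambda>t. - ml_relax a l t / l) has_vector_derivative ml_kernel a l x) (at x)"
      using assms(4) by (simp add: has_real_derivative_iff_has_vector_derivative)
  qed
  then show ?thesis by (simp add: diff_divide_distrib)
qed

lemma ml_relax_diff_le:
  assumes "0 < a" "0 < s" "s < t"
    and le: "\<And>x. s < x \<Longrightarrow> l * ml_kernel a l x \<le> B"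
  shows "ml_relax a l s - ml_relax a l t \<le> (t - s) * B"
proof -
  obtain z where z: "s < z" and "ml_relax a l t - ml_relax a l s = (t - s) * (- l * ml_kernel a l z)"
    using MVT2[of s t "ml_relax a l" "\<lambda>t. - l * ml_kernel a l t"] ml_relax_has_derivative assms(1-3)
    by force
  then have "ml_relax a l s - ml_relax a l t = (t - s) * (l * ml_kernel a l z)" by simp
  also have "\<dots> \<le> (t - s) * B"
    using assms(3) by (intro mult_left_mono le z) auto
  finally show ?thesis .
qed

lemma ml_relax_diff_le_inverse:
  assumes "0 < a" "a \<le> 1" "0 \<le> l" "0 < s" "s < t"
  shows "ml_relax a l s - ml_relax a l t \<le> (t - s) * (a / s)"
proof (rule ml_relax_diff_le)
  fix x assume "s < x"
  then have "l * ml_kernel a l x \<le> a / x"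
    using assms by (intro mult_ml_kernel_le) auto
  also have "\<dots> \<le> a / s"
    using \<open>s < x\<close> assms by (intro divide_left_mono) auto
  finally show "l * ml_kernel a l x \<le> a / s" .
qed (use assms in auto)

lemma abs_ml_relax_diff_le_powr:
  assumes "0 < a" "a \<le> 1" "0 < l" "0 < s" "s < t"
  shows "l * \<bar>ml_relax a l s - ml_relax a l t\<bar> \<le> (t - s) * (4 * a / Gamma (2 - a) * s powr (- 1 - a))"
proof -
  define B where "B = 4 * a / Gamma (2 - a) * s powr (- 1 - a)"
  have "ml_relax a l s - ml_relax a l t \<le> (t - s) * (B / l)"
  proof (rule ml_relax_diff_le)
    fix x assume "s < x"
    have "l\<^sup>2 * ml_kernel a l x \<le> 4 * a / Gamma (2 - a) * x powr (- 1 - a)"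
      using \<open>s < x\<close> assms by (intro power2_mult_ml_kernel_le) auto
    also have "\<dots> \<le> B"
      unfolding B_def using \<open>s < x\<close> assms Gamma_real_pos[of "2 - a"]
      by (intro mult_left_mono powr_mono2') auto
    finally show "l * ml_kernel a l x \<le> B / l"
      using assms(3) by (simp add: power2_eq_square field_simps)
  qed (use assms in auto)
  moreover have "ml_relax a l t \<le> ml_relax a l s"
    using assms by (intro ml_relax_antimono) auto
  ultimately show ?thesis
    using assms(3) unfolding B_def[symmetric] by (simp add: pos_le_divide_eq mult.commute)
qed

section \<open>Convolution with the relaxation kernel\<close>

lemma ml_kernel_mult_integrable:
  assumes "0 < a" "a \<le> 1" "0 \<le> s" "0 < l" "continuous_on {s..t} h"
  shows "(\<lambda>x. ml_kernel a l x * h x) integrable_on {s..t}"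
proof (cases "s \<le> t")
  case True
  have "ml_kernel a l absolutely_integrable_on {s..t}"
    using ml_kernel_has_integral[of a s t l] True assms ml_kernel_nonneg[of a l]
    by (intro nonnegative_absolutely_integrable_1) auto
  then have "(\<lambda>x. h x * ml_kernel a l x) absolutely_integrable_on {s..t}"
    using assms(5)
    by (intro absolutely_integrable_bounded_measurable_product_real)
       (auto intro: continuous_imp_measurable_on_sets_lebesgue compact_imp_bounded
          compact_continuous_image)
  then show ?thesis by (simp add: mult.commute set_lebesgue_integral_eq_integral(1))
qed (simp add: integrable_on_empty)

lemma abs_integral_ml_kernel_mult_le:
  assumes "0 < a" "a \<le> 1" "0 < l" "0 \<le> s" "s \<le> t"
    and h: "continuous_on {s..t} h" "\<And>x. x \<in> {s..t} \<Longrightarrow> \<bar>h x\<bar> \<le> M"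
  shows "l * \<bar>integral {s..t} (\<lambda>x. ml_kernel a l x * h x)\<bar> \<le> (ml_relax a l s - ml_relax a l t) * M"
proof -
  have majorant: "((\<lambda>x. ml_kernel a l x * M) has_integral
      ((ml_relax a l s - ml_relax a l t) / l * M)) {s..t}"
    using assms by (intro has_integral_mult_left ml_kernel_has_integral) auto
  have "norm (integral {s..t} (\<lambda>x. ml_kernel a l x * h x)) \<le> integral {s..t} (\<lambda>x. ml_kernel a l x * M)"
    using assms ml_kernel_nonneg[of a l] majorant
    by (intro integral_norm_bound_integral ml_kernel_mult_integrable)
       (auto simp: abs_mult intro!: mult_left_mono)
  then show ?thesis
    using assms(3) unfolding integral_unique[OF majorant] by (simp add: field_simps)
qed

text \<open>The kernel carries the integration variable and \<open>g\<close> the reflected one, so that in increments in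
  \<open>t\<close> only the smooth factor \<open>g\<close> is shifted.\<close>

definition ml_duhamel :: "real \<Rightarrow> real \<Rightarrow> (real \<Rightarrow> real) \<Rightarrow> real \<Rightarrow> real" where
  "ml_duhamel a l g t = integral {0..t} (\<lambda>s. ml_kernel a l s * g (t - s))"

lemma has_integral_reflect_interval:
  fixes f :: "real \<Rightarrow> 'b::real_normed_vector"
  assumes "(f has_integral I) {0..t}"
  shows "((\<lambda>s. f (t - s)) has_integral I) {0..t}"
  using has_integral_affinity[of f I 0 t "- 1" t] assms by (simp add: image_image)

lemma continuous_on_reflect:
  fixes g :: "real \<Rightarrow> 'b::topological_space"
  assumes "continuous_on {0..T} g" "\<And>x. x \<in> S \<Longrightarrow> t - x \<in> {0..T}"
  shows "continuous_on S (\<lambda>x. g (t - x))"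
  using assms by (intro continuous_on_compose2[OF assms(1)] continuous_intros) auto

lemma ml_kernel_mult_reflect_has_integral:
  assumes "0 < a" "a \<le> 1" "0 < l" "continuous_on {0..t} g"
  shows "((\<lambda>s. ml_kernel a l s * g (t - s)) has_integral ml_duhamel a l g t) {0..t}"
  unfolding ml_duhamel_def using assms
  by (intro integrable_integral ml_kernel_mult_integrable continuous_on_reflect[OF assms(4)]) auto

lemma ml_duhamel_has_integral:
  assumes "0 < a" "a \<le> 1" "0 < l" "continuous_on {0..t} g"
  shows "((\<lambda>s. ml_kernel a l (t - s) * g s) has_integral ml_duhamel a l g t) {0..t}"
  using has_integral_reflect_interval[OF ml_kernel_mult_reflect_has_integral[OF assms]] by simp

lemma ml_duhamel_ge:
  assumes "0 < a" "a \<le> 1" "0 < l" "0 \<le> t"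
    and g: "continuous_on {0..t} g" "\<And>s. s \<in> {0..t} \<Longrightarrow> c \<le> g s"
  shows "c * (1 - ml_relax a l t) \<le> l * ml_duhamel a l g t"
proof -
  have "((\<lambda>s. ml_kernel a l s * c) has_integral ((ml_relax a l 0 - ml_relax a l t) / l * c)) {0..t}"
    using assms by (intro has_integral_mult_left ml_kernel_has_integral) auto
  then have "(ml_relax a l 0 - ml_relax a l t) / l * c \<le> ml_duhamel a l g t"
    by (rule has_integral_le[OF _ ml_kernel_mult_reflect_has_integral])
       (use assms ml_kernel_nonneg in \<open>auto intro!: mult_left_mono\<close>)
  then show ?thesis using assms(1,3) by (simp add: field_simps)
qed

lemma abs_ml_duhamel_le:
  assumes "0 < a" "a \<le> 1" "0 < l" "0 \<le> t"
    and g: "continuous_on {0..t} g" "\<And>s. s \<in> {0..t} \<Longrightarrow> \<bar>g s\<bar> \<le> M"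
  shows "l * \<bar>ml_duhamel a l g t\<bar> \<le> M"
proof -
  have "\<bar>g 0\<bar> \<le> M" using assms(4) by (intro g) auto
  then have M: "0 \<le> M" by linarith
  have "l * \<bar>ml_duhamel a l g t\<bar> \<le> (ml_relax a l 0 - ml_relax a l t) * M"
    unfolding ml_duhamel_def using assms
    by (intro abs_integral_ml_kernel_mult_le continuous_on_reflect[OF g(1)]) auto
  also have "\<dots> \<le> 1 * M"
    using assms M ml_relax_nonneg[of a l t] by (intro mult_right_mono) auto
  finally show ?thesis by simp
qed

lemma ml_duhamel_diff_eq:
  assumes "0 < a" "a \<le> 1" "0 < l" "0 \<le> s" "s \<le> t" "continuous_on {0..t} g"
  shows "ml_duhamel a l g t - ml_duhamel a l g s
    = integral {s..t} (\<lambda>x. ml_kernel a l x * g (t - x))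
    + integral {0..s} (\<lambda>x. ml_kernel a l x * (g (t - x) - g (s - x)))"
proof -
  let ?f = "\<lambda>r x. ml_kernel a l x * g (r - x)"
  have integrable: "?f t integrable_on {0..t}" "?f t integrable_on {0..s}" "?f s integrable_on {0..s}"
    using assms by (auto intro!: ml_kernel_mult_integrable continuous_on_reflect[OF assms(6)])
  have "ml_duhamel a l g t = integral {0..s} (?f t) + integral {s..t} (?f t)"
    unfolding ml_duhamel_def using assms(4,5)
    by (intro Henstock_Kurzweil_Integration.integral_combine[symmetric] integrable) auto
  moreover have "integral {0..s} (?f t) - ml_duhamel a l g s
      = integral {0..s} (\<lambda>x. ml_kernel a l x * (g (t - x) - g (s - x)))"
    unfolding ml_duhamel_def right_diff_distrib
    by (rule Henstock_Kurzweil_Integration.integral_diff[OF integrable(2,3), symmetric])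
  ultimately show ?thesis by simp
qed

lemma abs_ml_duhamel_diff_le:
  assumes a: "0 < a" "a \<le> 1" and "0 < l" "0 < s" "s < t"
    and lipschitz: "L-lipschitz_on {0..t} g" and bound: "\<And>x. x \<in> {0..t} \<Longrightarrow> \<bar>g x\<bar> \<le> M"
  shows "l * \<bar>ml_duhamel a l g t - ml_duhamel a l g s\<bar> \<le> (t - s) * (L + M * a / s)"
proof -
  have g: "continuous_on {0..t} g" by (rule lipschitz_on_continuous_on[OF lipschitz])
  have L: "0 \<le> L" by (rule lipschitz_on_nonneg[OF lipschitz])
  have "\<bar>g 0\<bar> \<le> M" using assms(4,5) by (intro bound) auto
  then have M: "0 \<le> M" by linarith
  have recent: "l * \<bar>integral {s..t} (\<lambda>x. ml_kernel a l x * g (t - x))\<bar>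
      \<le> (ml_relax a l s - ml_relax a l t) * M"
    using assms by (intro abs_integral_ml_kernel_mult_le continuous_on_reflect[OF g]) auto
  have "\<bar>g (t - x) - g (s - x)\<bar> \<le> L * (t - s)" if "x \<in> {0..s}" for x
    using lipschitz_onD[OF lipschitz, of "t - x" "s - x"] that assms(5) by (simp add: dist_real_def)
  then have shifted: "l * \<bar>integral {0..s} (\<lambda>x. ml_kernel a l x * (g (t - x) - g (s - x)))\<bar>
      \<le> (ml_relax a l 0 - ml_relax a l s) * (L * (t - s))"
    using assms
    by (intro abs_integral_ml_kernel_mult_le continuous_on_diff continuous_on_reflect[OF g]) auto
  have "l * \<bar>ml_duhamel a l g t - ml_duhamel a l g s\<bar>
      \<le> l * (\<bar>integral {s..t} (\<lambda>x. ml_kernel a l x * g (t - x))\<bar>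
        + \<bar>integral {0..s} (\<lambda>x. ml_kernel a l x * (g (t - x) - g (s - x)))\<bar>)"
    using assms g by (intro mult_left_mono) (auto simp: ml_duhamel_diff_eq)
  also have "\<dots> \<le> (ml_relax a l s - ml_relax a l t) * M
      + (ml_relax a l 0 - ml_relax a l s) * (L * (t - s))"
    unfolding distrib_left by (intro add_mono recent shifted)
  also have "\<dots> \<le> (t - s) * (a / s) * M + 1 * (L * (t - s))"
    using ml_relax_diff_le_inverse[of a l s t] ml_relax_nonneg[of a l s] assms L M
    by (intro add_mono mult_right_mono) auto
  finally show ?thesis by (simp add: algebra_simps)
qed

section \<open>Orthonormal bases and multipliers\<close>

locale orthonormal_sequence =
  fixes phi :: "nat \<Rightarrow> 'h::{real_inner,complete_space}"
  assumes inner_phi: "phi m \<bullet> phi n = (if m = n then 1 else 0)"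
begin

lemma inner_sum_phi:
  assumes "finite A"
  shows "(\<Sum>n\<in>A. c n *\<^sub>R phi n) \<bullet> phi m = (if m \<in> A then c m else 0)"
  using assms by (simp add: inner_sum_left inner_phi if_distrib cong: if_cong)

lemma norm_sum_phi:
  assumes "finite A"
  shows "(norm (\<Sum>n\<in>A. c n *\<^sub>R phi n))\<^sup>2 = (\<Sum>n\<in>A. (c n)\<^sup>2)"
proof -
  have "(norm (\<Sum>n\<in>A. c n *\<^sub>R phi n))\<^sup>2 = (\<Sum>m\<in>A. c m * ((\<Sum>n\<in>A. c n *\<^sub>R phi n) \<bullet> phi m))"
    by (simp add: power2_norm_eq_inner inner_sum_right)
  also have "\<dots> = (\<Sum>m\<in>A. (c m)\<^sup>2)"
    using assms by (simp add: inner_sum_phi power2_eq_square)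
  finally show ?thesis .
qed

lemma summable_phi:
  assumes "summable (\<lambda>n. (c n)\<^sup>2)"
  shows "summable (\<lambda>n. c n *\<^sub>R phi n)"
proof -
  let ?S = "\<lambda>n. \<Sum>i<n. c i *\<^sub>R phi i"
  have "Cauchy ?S"
  proof (rule metric_CauchyI)
    fix e :: real assume e: "0 < e"
    then obtain N where N: "\<And>m n. N \<le> m \<Longrightarrow> norm (\<Sum>i=m..<n. (c i)\<^sup>2) < e\<^sup>2"
      using assms unfolding summable_Cauchy by (meson zero_less_power)
    have "dist (?S n) (?S m) < e" if "N \<le> m" "m \<le> n" for m n
    proof -
      have "?S n - ?S m = (\<Sum>i=m..<n. c i *\<^sub>R phi i)"
        using sum_diff_nat_ivl[of 0 m n "\<lambda>i. c i *\<^sub>R phi i"] that by (simp add: atLeast0LessThan)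
      then have "(dist (?S n) (?S m))\<^sup>2 = (\<Sum>i=m..<n. (c i)\<^sup>2)"
        by (simp add: dist_norm norm_sum_phi)
      also have "\<dots> < e\<^sup>2" using N[OF that(1), of n] by simp
      finally show ?thesis using e by (simp add: power2_less_imp_less)
    qed
    then show "\<exists>M. \<forall>m\<ge>M. \<forall>n\<ge>M. dist (?S m) (?S n) < e"
      by (metis dist_commute nle_le)
  qed
  then show ?thesis
    using Cauchy_convergent summable_iff_convergent by blast
qed

lemma inner_suminf_phi:
  assumes "summable (\<lambda>n. (c n)\<^sup>2)"
  shows "(\<Sum>n. c n *\<^sub>R phi n) \<bullet> phi m = c m"
proof -
  have "(\<lambda>n. (c n *\<^sub>R phi n) \<bullet> phi m) sums ((\<Sum>n. c n *\<^sub>R phi n) \<bullet> phi m)"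
    by (intro bounded_linear.sums[OF bounded_linear_inner_left] summable_sums summable_phi assms)
  moreover have "(c n *\<^sub>R phi n) \<bullet> phi m = (if n = m then c n else 0)" for n
    by (simp add: inner_phi)
  ultimately have "(\<lambda>n. if n = m then c n else 0) sums ((\<Sum>n. c n *\<^sub>R phi n) \<bullet> phi m)"
    by (simp only:)
  then show ?thesis using sums_single[of m c] sums_unique2 by blast
qed

lemma bessel_inequality: "(\<Sum>n<N. (v \<bullet> phi n)\<^sup>2) \<le> (norm v)\<^sup>2"
proof -
  define s where "s = (\<Sum>n<N. (v \<bullet> phi n) *\<^sub>R phi n)"
  have "s \<bullet> s = (\<Sum>n<N. (v \<bullet> phi n)\<^sup>2)"
    unfolding s_def power2_norm_eq_inner[symmetric] by (rule norm_sum_phi) simp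
  moreover have "v \<bullet> s = (\<Sum>n<N. (v \<bullet> phi n)\<^sup>2)"
    by (simp add: s_def inner_sum_right power2_eq_square)
  moreover have "0 \<le> (v - s) \<bullet> (v - s)" by simp
  ultimately show ?thesis
    by (simp add: power2_norm_eq_inner inner_diff_left inner_diff_right inner_commute)
qed

lemma summable_inner_phi_power2: "summable (\<lambda>n. (v \<bullet> phi n)\<^sup>2)"
  by (rule summableI_nonneg_bounded[OF _ bessel_inequality]) simp

end

locale orthonormal_basis = orthonormal_sequence phi
  for phi :: "nat \<Rightarrow> 'h::{real_inner,complete_space}" +
  assumes complete: "(\<And>n. v \<bullet> phi n = 0) \<Longrightarrow> v = 0"
begin

lemma eqI_inner_phi:
  assumes "\<And>n. v \<bullet> phi n = w \<bullet> phi n"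
  shows "v = w"
  using complete[of "v - w"] assms by (simp add: inner_diff_left)

lemma inner_phi_sums: "(\<lambda>n. (v \<bullet> phi n) *\<^sub>R phi n) sums v"
proof -
  have "(\<Sum>n. (v \<bullet> phi n) *\<^sub>R phi n) = v"
    by (intro eqI_inner_phi inner_suminf_phi summable_inner_phi_power2)
  then show ?thesis
    using summable_sums[OF summable_phi[OF summable_inner_phi_power2]] by metis
qed

lemma norm_inner_phi_tail_tendsto_0:
  "(\<lambda>N. norm (v - (\<Sum>n<N. (v \<bullet> phi n) *\<^sub>R phi n))) \<longlonglongrightarrow> 0"
proof -
  have "(\<lambda>N. norm (v - (\<Sum>n<N. (v \<bullet> phi n) *\<^sub>R phi n))) \<longlonglongrightarrow> norm (v - v)"
    using inner_phi_sums[of v] unfolding sums_def by (intro tendsto_intros)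
  then show ?thesis by simp
qed

lemma parseval: "(\<lambda>n. (v \<bullet> phi n)\<^sup>2) sums (norm v)\<^sup>2"
proof -
  have "(\<lambda>N. (norm (\<Sum>n<N. (v \<bullet> phi n) *\<^sub>R phi n))\<^sup>2) \<longlonglongrightarrow> (norm v)\<^sup>2"
    using inner_phi_sums[of v] unfolding sums_def by (intro tendsto_intros)
  then show ?thesis
    by (simp add: sums_def norm_sum_phi)
qed

definition multiplier :: "(nat \<Rightarrow> real) \<Rightarrow> 'h \<Rightarrow> 'h" where
  "multiplier m v = (\<Sum>n. (m n * (v \<bullet> phi n)) *\<^sub>R phi n)"

lemma inner_multiplier:
  assumes "summable (\<lambda>n. (m n * (v \<bullet> phi n))\<^sup>2)"
  shows "multiplier m v \<bullet> phi n = m n * (v \<bullet> phi n)"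
  unfolding multiplier_def by (rule inner_suminf_phi[OF assms])

context
  fixes m :: "nat \<Rightarrow> real" and B :: real
  assumes bound: "\<And>n. \<bar>m n\<bar> \<le> B"
begin

lemma power2_bounded_coefficient_le: "(m n * (v \<bullet> phi n))\<^sup>2 \<le> B\<^sup>2 * (v \<bullet> phi n)\<^sup>2"
  using power_mono[OF bound, of n 2] by (simp add: power_mult_distrib mult_right_mono)

lemma summable_bounded_coefficients: "summable (\<lambda>n. (m n * (v \<bullet> phi n))\<^sup>2)"
  by (rule summable_comparison_test'[OF summable_mult[OF summable_inner_phi_power2]])
     (use power2_bounded_coefficient_le in simp)

lemma inner_bounded_multiplier: "multiplier m v \<bullet> phi n = m n * (v \<bullet> phi n)"
  by (rule inner_multiplier[OF summable_bounded_coefficients])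

lemma norm_bounded_multiplier_le: "norm (multiplier m v) \<le> B * norm v"
proof (rule power2_le_imp_le)
  have "(norm (multiplier m v))\<^sup>2 \<le> B\<^sup>2 * (norm v)\<^sup>2"
  proof (rule sums_le[OF _ parseval sums_mult[OF parseval]])
    show "(multiplier m v \<bullet> phi n)\<^sup>2 \<le> B\<^sup>2 * (v \<bullet> phi n)\<^sup>2" for n
      unfolding inner_bounded_multiplier by (rule power2_bounded_coefficient_le)
  qed
  then show "(norm (multiplier m v))\<^sup>2 \<le> (B * norm v)\<^sup>2" by (simp add: power_mult_distrib)
  show "0 \<le> B * norm v" using bound[of 0] by simp
qed

lemma norm_bounded_multiplier_minus_partial_sum_le:
  "norm (multiplier m v - (\<Sum>n<N. (m n * (v \<bullet> phi n)) *\<^sub>R phi n))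
    \<le> B * norm (v - (\<Sum>n<N. (v \<bullet> phi n) *\<^sub>R phi n))"
proof -
  have "multiplier m v - (\<Sum>n<N. (m n * (v \<bullet> phi n)) *\<^sub>R phi n)
      = multiplier m (v - (\<Sum>n<N. (v \<bullet> phi n) *\<^sub>R phi n))"
    by (rule eqI_inner_phi) (simp add: inner_diff_left inner_sum_phi inner_bounded_multiplier)
  then show ?thesis by (simp add: norm_bounded_multiplier_le)
qed

end

text \<open>The coefficients give \<open>l * G * (p - p') = l * w - l * r * u + l * (G' - G) * p'\<close>, which is then
  divided by \<open>l * G\<close>.\<close>

lemma norm_diff_le_of_coefficients:
  assumes w: "summable (\<lambda>n. (l n * (w \<bullet> phi n))\<^sup>2)"
    and coefficients: "\<And>n. w \<bullet> phi n = r n * (u \<bullet> phi n) + G n * (p \<bullet> phi n) - G' n * (p' \<bullet> phi n)"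
    and G: "0 < d" "\<And>n. d \<le> l n * G n"
    and r: "\<And>n. \<bar>l n * r n\<bar> \<le> B" and G_diff: "\<And>n. \<bar>l n * (G' n - G n)\<bar> \<le> C"
  shows "d * norm (p - p') \<le> norm (multiplier l w) + B * norm u + C * norm p'"
proof -
  define rhs where "rhs = multiplier l w - multiplier (\<lambda>n. l n * r n) u
    + multiplier (\<lambda>n. l n * (G' n - G n)) p'"
  have pos: "0 < l n * G n" for n
    using G(1) G(2)[of n] by linarith
  have inverse_le: "\<bar>1 / (l n * G n)\<bar> \<le> 1 / d" for n
    using pos[of n] G by (simp add: frac_le)
  have "p - p' = multiplier (\<lambda>n. 1 / (l n * G n)) rhs"
  proof (rule eqI_inner_phi)
    fix n
    have nonzero: "l n \<noteq> 0" "G n \<noteq> 0" using pos[of n] by auto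
    have "l n * G n * ((p - p') \<bullet> phi n) = rhs \<bullet> phi n"
      unfolding rhs_def inner_diff_left inner_add_left inner_multiplier[OF w]
        inner_bounded_multiplier[OF r] inner_bounded_multiplier[OF G_diff] coefficients
      by (simp add: algebra_simps)
    then show "(p - p') \<bullet> phi n = multiplier (\<lambda>n. 1 / (l n * G n)) rhs \<bullet> phi n"
      unfolding inner_bounded_multiplier[OF inverse_le] using nonzero by (simp add: field_simps)
  qed
  then have "d * norm (p - p') \<le> norm rhs"
    using norm_bounded_multiplier_le[OF inverse_le, where v = rhs] G(1) by (simp add: field_simps)
  also have "\<dots> \<le> norm (multiplier l w) + norm (multiplier (\<lambda>n. l n * r n) u)
      + norm (multiplier (\<lambda>n. l n * (G' n - G n)) p')"
    unfolding rhs_def by norm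
  also have "\<dots> \<le> norm (multiplier l w) + B * norm u + C * norm p'"
    by (intro add_mono order_refl norm_bounded_multiplier_le r G_diff)
  finally show ?thesis .
qed

end

section \<open>The solution operators as multipliers\<close>

text \<open>The majorants replace measurability, which dominated convergence would require of \<open>f\<close> and the
  \<open>F N\<close>; the target need be neither separable nor complete.\<close>

lemma has_integral_dominated_approximation:
  fixes f :: "'a::euclidean_space \<Rightarrow> 'b::real_normed_vector"
  assumes F: "\<And>N. (F N has_integral L N) (cbox a b)" and L: "L \<longlonglongrightarrow> I"
    and h: "\<And>N. (h N has_integral H N) (cbox a b)" and H: "H \<longlonglongrightarrow> 0"
    and le: "\<And>N x. x \<in> cbox a b \<Longrightarrow> norm (f x - F N x) \<le> h N x"
  shows "(f has_integral I) (cbox a b)"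
  unfolding has_integral_cbox
proof (rule tendstoI)
  fix e :: real assume e: "0 < e"
  have "\<forall>\<^sub>F N in sequentially. dist (L N) I < e / 4 \<and> H N < e / 4"
    using L H e by (intro eventually_conj tendstoD order_tendstoD) auto
  then obtain N where N: "dist (L N) I < e / 4" "H N < e / 4"
    using eventually_happens' sequentially_bot by blast
  let ?S = "\<lambda>D f. \<Sum>(x, k)\<in>D. measure lborel k *\<^sub>R f x"
  have "\<forall>\<^sub>F D in division_filter (cbox a b). dist (?S D (F N)) (L N) < e / 4"
    using F[of N] e unfolding has_integral_cbox by (intro tendstoD) auto
  moreover have "\<forall>\<^sub>F D in division_filter (cbox a b). dist (?S D (h N)) (H N) < e / 4"
    using h[of N] e unfolding has_integral_cbox by (intro tendstoD) auto
  ultimately show "\<forall>\<^sub>F D in division_filter (cbox a b). dist (?S D f) I < e"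
    using eventually_division_filter_tagged_division
  proof eventually_elim
    case (elim D)
    have "dist (?S D f) (?S D (F N)) = norm (\<Sum>(x, k)\<in>D. measure lborel k *\<^sub>R (f x - F N x))"
      by (simp add: dist_norm sum_subtractf[symmetric] scaleR_diff_right split_def)
    also have "\<dots> \<le> ?S D (h N)"
      by (rule sum_norm_le) (use elim(3) in \<open>auto intro!: mult_left_mono le dest: tag_in_interval\<close>)
    also have "\<dots> < e / 2"
      using elim(2) N(2) unfolding dist_real_def by linarith
    finally show ?case
      using elim(1) N(1) dist_triangle[of "?S D f" I "?S D (F N)"] dist_triangle[of "?S D (F N)" I "L N"]
      by linarith
  qed
qed

locale fractional_diffusion =
  fixes phi :: "nat \<Rightarrow> 'h::{real_inner,complete_space}" and lam :: "nat \<Rightarrow> real" and a :: real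
  assumes spectral_data: "spectral_data phi lam"
    and a: "0 < a" "a \<le> 1"
begin

sublocale orthonormal_basis phi
  using spectral_data by unfold_locales (auto simp: spectral_data_def)

lemma lam_0_le: "lam 0 \<le> lam n"
  using spectral_data by (simp add: spectral_data_def mono_def)

lemma lam_pos: "0 < lam n"
  using spectral_data lam_0_le[of n] by (simp add: spectral_data_def)

lemma
  shows solF_eq_multiplier: "solF phi lam a t = multiplier (\<lambda>n. ml_relax a (lam n) t)"
    and solE_eq_multiplier: "solE phi lam a t = multiplier (\<lambda>n. ml_kernel a (lam n) t)"
    and opA_eq_multiplier: "opA phi lam = multiplier lam"
  by (simp_all add: fun_eq_iff multiplier_def solF_def solE_def opA_def ml_relax_def ml_kernel_def)

lemma abs_ml_relax_le: "\<bar>ml_relax a (lam n) t\<bar> \<le> 1"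
  using ml_relax_nonneg[of a "lam n" t] ml_relax_le_1[of a "lam n" t] a lam_pos[of n] by simp

lemma abs_ml_duhamel_lam_le:
  assumes "0 \<le> t" "continuous_on {0..t} g" "\<And>s. s \<in> {0..t} \<Longrightarrow> \<bar>g s\<bar> \<le> M"
  shows "\<bar>ml_duhamel a (lam n) g t\<bar> \<le> M / lam 0"
proof -
  have "lam 0 * \<bar>ml_duhamel a (lam n) g t\<bar> \<le> lam n * \<bar>ml_duhamel a (lam n) g t\<bar>"
    by (intro mult_right_mono lam_0_le) auto
  also have "\<dots> \<le> M"
    using assms a lam_pos by (intro abs_ml_duhamel_le) auto
  finally show ?thesis
    using lam_pos[of 0] by (simp add: field_simps)
qed

lemma mult_ml_duhamel_lam_ge:
  assumes "0 \<le> s" "s \<le> t" "continuous_on {0..t} g" "0 \<le> c" "\<And>r. r \<in> {0..t} \<Longrightarrow> c \<le> g r"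
  shows "c * (1 - ml_relax a (lam 0) s) \<le> lam n * ml_duhamel a (lam n) g t"
proof -
  have "c * (1 - ml_relax a (lam 0) s) \<le> c * (1 - ml_relax a (lam n) t)"
    using a lam_0_le[of n] lam_pos[of 0] assms
    by (intro mult_left_mono diff_left_mono ml_relax_antimono) auto
  also have "\<dots> \<le> lam n * ml_duhamel a (lam n) g t"
    using a lam_pos assms by (intro ml_duhamel_ge) auto
  finally show ?thesis .
qed

lemma solE_has_integral:
  assumes t: "0 \<le> t" and g: "continuous_on {0..t} g" "\<And>s. s \<in> {0..t} \<Longrightarrow> \<bar>g s\<bar> \<le> M"
  shows "((\<lambda>s. solE phi lam a (t - s) (g s *\<^sub>R psi)) has_integral
           multiplier (\<lambda>n. ml_duhamel a (lam n) g t) psi) {0..t}"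
proof -
  define tail where "tail N = norm (psi - (\<Sum>n<N. (psi \<bullet> phi n) *\<^sub>R phi n))" for N
  show ?thesis
  proof (rule has_integral_dominated_approximation[where 'a = real, unfolded box_real])
    show "((\<lambda>s. \<Sum>n<N. (ml_kernel a (lam n) (t - s) * g s * (psi \<bullet> phi n)) *\<^sub>R phi n) has_integral
            (\<Sum>n<N. (ml_duhamel a (lam n) g t * (psi \<bullet> phi n)) *\<^sub>R phi n)) {0..t}" for N
      using a lam_pos g(1)
      by (intro has_integral_sum has_integral_scaleR_left has_integral_mult_left
          ml_duhamel_has_integral) auto
    show "(\<lambda>N. \<Sum>n<N. (ml_duhamel a (lam n) g t * (psi \<bullet> phi n)) *\<^sub>R phi n)
        \<longlonglongrightarrow> multiplier (\<lambda>n. ml_duhamel a (lam n) g t) psi"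
      unfolding multiplier_def
      by (intro summable_LIMSEQ summable_phi
          summable_bounded_coefficients[OF abs_ml_duhamel_lam_le[OF assms]])
    have "((\<lambda>s. s powr (a - 1)) has_integral (t powr (a - 1 + 1) / (a - 1 + 1))) {0..t}"
      using a t by (intro has_integral_powr_from_0) auto
    from has_integral_reflect_interval[OF this]
    show "((\<lambda>s. (t - s) powr (a - 1) / Gamma a * M * tail N) has_integral
        (t powr a / a / Gamma a * M * tail N)) {0..t}" for N
      by (intro has_integral_mult_left has_integral_divide) simp
    show "(\<lambda>N. t powr a / a / Gamma a * M * tail N) \<longlonglongrightarrow> 0"
      unfolding tail_def by (intro tendsto_mult_right_zero norm_inner_phi_tail_tendsto_0)
    fix N s assume s: "s \<in> {0..t}"
    have "\<bar>ml_kernel a (lam n) (t - s) * g s\<bar> \<le> (t - s) powr (a - 1) / Gamma a * M" for n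
      unfolding abs_mult
      using ml_kernel_nonneg[of a "lam n"] ml_kernel_le[of a "lam n"] a lam_pos[of n] g(2)[OF s]
      by (intro mult_mono) (auto simp: Gamma_real_pos less_imp_le)
    from norm_bounded_multiplier_minus_partial_sum_le[OF this, where v = psi and N = N]
    show "norm (solE phi lam a (t - s) (g s *\<^sub>R psi)
        - (\<Sum>n<N. (ml_kernel a (lam n) (t - s) * g s * (psi \<bullet> phi n)) *\<^sub>R phi n))
        \<le> (t - s) powr (a - 1) / Gamma a * M * tail N"
      by (simp add: solE_eq_multiplier multiplier_def tail_def mult.assoc)
  qed
qed

lemma inner_solP:
  assumes "0 \<le> t" "continuous_on {0..t} g" "\<And>s. s \<in> {0..t} \<Longrightarrow> \<bar>g s\<bar> \<le> M"
  shows "solP phi lam a u0 (\<lambda>s. g s *\<^sub>R psi) t \<bullet> phi n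
    = ml_relax a (lam n) t * (u0 \<bullet> phi n) + ml_duhamel a (lam n) g t * (psi \<bullet> phi n)"
proof -
  have "solP phi lam a u0 (\<lambda>s. g s *\<^sub>R psi) t
      = multiplier (\<lambda>n. ml_relax a (lam n) t) u0 + multiplier (\<lambda>n. ml_duhamel a (lam n) g t) psi"
    unfolding solP_def solF_eq_multiplier by (simp only: integral_unique[OF solE_has_integral[OF assms]])
  then show ?thesis
    by (simp only: inner_add_left inner_bounded_multiplier[OF abs_ml_relax_le]
        inner_bounded_multiplier[OF abs_ml_duhamel_lam_le, OF assms])
qed

end

section \<open>The stability estimate\<close>

lemma C2_boundedD:
  assumes "C2_bounded T M g" "0 \<le> T"
  shows "t \<in> {0..T} \<Longrightarrow> \<bar>g t\<bar> \<le> M"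
    and "0 \<le> M"
    and "M-lipschitz_on {0..T} g"
proof -
  from assms(1) obtain g1 where g1: "\<And>t. t \<in> {0..T} \<Longrightarrow> (g has_real_derivative g1 t) (at t within {0..T})"
    and bound: "\<And>t. t \<in> {0..T} \<Longrightarrow> \<bar>g t\<bar> \<le> M" "\<And>t. t \<in> {0..T} \<Longrightarrow> \<bar>g1 t\<bar> \<le> M"
    unfolding C2_bounded_def by blast
  show "t \<in> {0..T} \<Longrightarrow> \<bar>g t\<bar> \<le> M" by (rule bound(1))
  have "\<bar>g 0\<bar> \<le> M" using assms(2) by (intro bound) auto
  then show M: "0 \<le> M" by linarith
  show "M-lipschitz_on {0..T} g"
    using field_differentiable_bound[of "{0..T}" g g1 M] g1 bound(2) M
    by (intro lipschitz_onI) (auto simp: dist_norm)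
qed

context fractional_diffusion
begin

lemma norm_source_diff_le:
  fixes u0 psi psi' :: 'h and g :: "real \<Rightarrow> real"
  assumes T0: "0 < T0" "T0 \<le> T" and T: "T < T'"
    and g: "L-lipschitz_on {0..T'} g" "\<And>s. s \<in> {0..T'} \<Longrightarrow> \<bar>g s\<bar> \<le> M"
    and cg: "0 < cg" "\<And>s. s \<in> {0..T'} \<Longrightarrow> cg \<le> g s"
  defines "w \<equiv> solP phi lam a u0 (\<lambda>s. g s *\<^sub>R psi) T - solP phi lam a u0 (\<lambda>s. g s *\<^sub>R psi') T'"
  assumes w: "w \<in> domA phi lam"
  shows "cg * (1 - ml_relax a (lam 0) T0) * norm (psi - psi') \<le> norm (opA phi lam w)
    + (T' - T) * (4 * a / Gamma (2 - a) * T powr (- 1 - a)) * norm u0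
    + (T' - T) * (L + M * a / T) * norm psi'"
  unfolding opA_eq_multiplier
proof (rule norm_diff_le_of_coefficients)
  have T_pos: "0 < T" using T0 by simp
  have g_T': "continuous_on {0..T'} g" by (rule lipschitz_on_continuous_on[OF g(1)])
  then have g_T: "continuous_on {0..T} g" by (rule continuous_on_subset) (use T in auto)
  show "summable (\<lambda>n. (lam n * (w \<bullet> phi n))\<^sup>2)" using w by (simp add: domA_def)
  show "0 < cg * (1 - ml_relax a (lam 0) T0)"
    using ml_relax_less_1[of a "lam 0" T0] a lam_pos T0 cg(1) by simp
  fix n
  have "w \<bullet> phi n = (ml_relax a (lam n) T * (u0 \<bullet> phi n) + ml_duhamel a (lam n) g T * (psi \<bullet> phi n))
      - (ml_relax a (lam n) T' * (u0 \<bullet> phi n) + ml_duhamel a (lam n) g T' * (psi' \<bullet> phi n))"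
    unfolding w_def inner_diff_left using T T_pos g(2)
    by (intro arg_cong2[of _ _ _ _ "(-)"] inner_solP[OF _ g_T, of M] inner_solP[OF _ g_T', of M]) auto
  then show "w \<bullet> phi n = (ml_relax a (lam n) T - ml_relax a (lam n) T') * (u0 \<bullet> phi n)
      + ml_duhamel a (lam n) g T * (psi \<bullet> phi n) - ml_duhamel a (lam n) g T' * (psi' \<bullet> phi n)"
    by (simp add: algebra_simps)
  show "cg * (1 - ml_relax a (lam 0) T0) \<le> lam n * ml_duhamel a (lam n) g T"
    using T0 T cg g_T by (intro mult_ml_duhamel_lam_ge) auto
  show "\<bar>lam n * (ml_relax a (lam n) T - ml_relax a (lam n) T')\<bar>
      \<le> (T' - T) * (4 * a / Gamma (2 - a) * T powr (- 1 - a))"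
    using abs_ml_relax_diff_le_powr[of a "lam n" T T'] a lam_pos[of n] T T_pos
    by (simp add: abs_mult)
  show "\<bar>lam n * (ml_duhamel a (lam n) g T' - ml_duhamel a (lam n) g T)\<bar> \<le> (T' - T) * (L + M * a / T)"
    using abs_ml_duhamel_diff_le[OF _ _ _ T_pos T g, of a "lam n"] a lam_pos[of n]
    by (simp add: abs_mult)
qed

lemma norm_C2_source_diff_le:
  fixes u0 psi psi' :: 'h and g :: "real \<Rightarrow> real"
  assumes "0 < T0" "T0 \<le> T" "T < T'" and C2: "C2_bounded T' M g"
    and cg: "0 < cg" "\<And>s. s \<in> {0..T'} \<Longrightarrow> cg \<le> g s"
  defines "w \<equiv> solP phi lam a u0 (\<lambda>s. g s *\<^sub>R psi) T - solP phi lam a u0 (\<lambda>s. g s *\<^sub>R psi') T'"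
  assumes w: "w \<in> domA phi lam"
  shows "cg * (1 - ml_relax a (lam 0) T0) * norm (psi - psi') \<le> (1 + 4 * a / Gamma (2 - a) + \<bar>M\<bar>) *
    (norm (opA phi lam w) + \<bar>T - T'\<bar> * T powr (- 1 - a) * norm u0
      + \<bar>T - T'\<bar> * (1 + 1 / T + T) * norm psi')"
proof -
  define K where "K = 1 + 4 * a / Gamma (2 - a) + \<bar>M\<bar>"
  have pos: "0 < T" "0 \<le> T'" using assms by simp_all
  note g = C2_boundedD[OF C2 pos(2)]
  have "0 \<le> 4 * a / Gamma (2 - a)"
    using a Gamma_real_pos[of "2 - a"] by simp
  then have K: "1 \<le> K" "4 * a / Gamma (2 - a) \<le> K" "M \<le> K"
    unfolding K_def by linarith+
  have "M + M * a / T = M * (1 + a / T)" by (simp add: algebra_simps)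
  also have "\<dots> \<le> K * (1 + 1 / T + T)"
    using K g(2) pos a by (intro mult_mono) (auto simp: divide_right_mono add_increasing2)
  finally have source_factor: "M + M * a / T \<le> K * (1 + 1 / T + T)" .
  have "cg * (1 - ml_relax a (lam 0) T0) * norm (psi - psi') \<le> norm (opA phi lam w)
      + (T' - T) * (4 * a / Gamma (2 - a) * T powr (- 1 - a)) * norm u0
      + (T' - T) * (M + M * a / T) * norm psi'"
    unfolding w_def using assms g by (intro norm_source_diff_le) auto
  also have "\<dots> \<le> K * norm (opA phi lam w) + (T' - T) * (K * T powr (- 1 - a)) * norm u0
      + (T' - T) * (K * (1 + 1 / T + T)) * norm psi'"
    using assms(3) K source_factor
    by (intro add_mono mult_right_mono mult_left_mono) (auto simp: mult_le_cancel_right1)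
  also have "\<dots> = K * (norm (opA phi lam w) + \<bar>T - T'\<bar> * T powr (- 1 - a) * norm u0
      + \<bar>T - T'\<bar> * (1 + 1 / T + T) * norm psi')"
    using assms(3) by (simp add: algebra_simps)
  finally show ?thesis unfolding K_def .
qed

end

theorem mainTheorem6:
  fixes phi :: "nat \<Rightarrow> 'h::{real_inner,complete_space}"
    and lam :: "nat \<Rightarrow> real"
    and a T0 cg M :: real
  assumes "spectral_data phi lam"
    and "0 < a" and "a < 1"
    and "0 < T0" and "0 < cg"
  shows "\<exists>c>0. \<forall>T T' g u0 psi psi'.
     T0 \<le> T \<longrightarrow> T < T' \<longrightarrow> C2_bounded T' M g \<longrightarrow> (\<forall>t\<in>{0..T'}. cg \<le> g t) \<longrightarrow>
     solP phi lam a u0 (\<lambda>s. g s *\<^sub>R psi) T - solP phi lam a u0 (\<lambda>s. g s *\<^sub>R psi') T' \<in> domA phi lam \<longrightarrow>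
     norm (psi - psi') \<le> c * (norm (opA phi lam (solP phi lam a u0 (\<lambda>s. g s *\<^sub>R psi) T
                                              - solP phi lam a u0 (\<lambda>s. g s *\<^sub>R psi') T'))
                               + \<bar>T - T'\<bar> * T powr (-1 - a) * norm u0
                               + \<bar>T - T'\<bar> * (1 + 1 / T + T) * norm psi')"
proof -
  interpret fractional_diffusion phi lam a
    using assms by unfold_locales auto
  define d where "d = cg * (1 - ml_relax a (lam 0) T0)"
  define K where "K = 1 + 4 * a / Gamma (2 - a) + \<bar>M\<bar>"
  have d: "0 < d"
    using ml_relax_less_1[of a "lam 0" T0] lam_pos assms by (simp add: d_def)
  have "0 < K"
    using assms Gamma_real_pos[of "2 - a"] unfolding K_def by (intro add_pos_nonneg) auto
  show ?thesis
  proof (intro exI[of _ "K / d"] conjI allI impI)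
    show "0 < K / d" using \<open>0 < K\<close> d by simp
    fix T T' :: real and g u0 psi psi'
    let ?w = "solP phi lam a u0 (\<lambda>s. g s *\<^sub>R psi) T - solP phi lam a u0 (\<lambda>s. g s *\<^sub>R psi') T'"
    let ?R = "norm (opA phi lam ?w) + \<bar>T - T'\<bar> * T powr (- 1 - a) * norm u0
      + \<bar>T - T'\<bar> * (1 + 1 / T + T) * norm psi'"
    assume "T0 \<le> T" "T < T'" "C2_bounded T' M g" "\<forall>t\<in>{0..T'}. cg \<le> g t" "?w \<in> domA phi lam"
    then have "d * norm (psi - psi') \<le> K * ?R"
      unfolding d_def K_def using assms(4,5) by (intro norm_C2_source_diff_le) auto
    then show "norm (psi - psi') \<le> K / d * ?R"
      using d by (simp add: pos_le_divide_eq mult.commute)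
  qed
qed

end
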